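(* Let $E$ and $X$ be non-empty path-connected spaces, let $e\in E$ be such that $\{e\}$ is closed in $E$, and let $p:E\to X$ have the continuous path-covering property. Then the induced homomorphism $p_{\#}:\pi_n(E,e)\to \pi_n(X,p(e))$ is a closed topological embedding for $n=1$ and an isomorphism of quasitopological groups (a group isomorphism which is also a homeomorphism) for every $n\geq 2$.
   Context: Maps are continuous. Let $I=[0,1]$. $P(Y,y)$ is the space of paths $\alpha:I\to Y$ with $\alpha(0)=y$, with the compact-open topology. A map $p:E\to X$ has the continuous path-covering property if for every $e\in E$ the induced map $P(p):P(E,e)\to P(X,p(e))$, $\alpha\mapsto p\circ\alpha$, is a homeomorphism. $\Omega^n(Y,y)$ is the space of maps $(I^n,\partial I^n)\to (Y,y)$ with the compact-open topology, and $\pi_n(Y,y)$ is given the quotient topology with respect to the map $\Omega^n(Y,y)\to\pi_n(Y,y)$ sending a map to its homotopy class rel. $\partial I^n$. With this topology $\pi_n(Y,y)$ is a quasitopological group (inversion and all left and right translations are continuous). *)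

theory Defs
  imports "HOL-Analysis.Analysis" "HOL-Algebra.Group"
begin

text \<open>
  Spaces are values of type \<open>'a topology\<close>.  The points of a function space are maps that are
  extensional on the domain (equal to \<open>undefined\<close> outside it), so that equality of points is equality
  of maps on the domain.
\<close>

definition maps :: "'a topology \<Rightarrow> 'b topology \<Rightarrow> ('a \<Rightarrow> 'b) set" where
  "maps A Y = {f. continuous_map A Y f \<and> f \<in> extensional (topspace A)}"

definition compact_open_topology :: "'a topology \<Rightarrow> 'b topology \<Rightarrow> ('a \<Rightarrow> 'b) topology" where
  "compact_open_topology A Y =
     topology_generated_by {{f \<in> maps A Y. f ` K \<subseteq> U} | K U. compactin A K \<and> openin Y U}"

lemma topspace_compact_open_topology [simp]:
  "topspace (compact_open_topology A Y) = maps A Y"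
proof -
  have "maps A Y \<in> {{f \<in> maps A Y. f ` K \<subseteq> U} | K U. compactin A K \<and> openin Y U}"
    by (rule CollectI, rule exI[of _ "{}"], rule exI[of _ "{}"]) auto
  then show ?thesis
    unfolding compact_open_topology_def topology_generated_by_topspace by blast
qed

abbreviation unit_interval :: "real topology" where
  "unit_interval \<equiv> top_of_set {0..1}"

definition path_space :: "'a topology \<Rightarrow> 'a \<Rightarrow> (real \<Rightarrow> 'a) topology" where
  "path_space Y y =
     subtopology (compact_open_topology unit_interval Y) {\<alpha> \<in> maps unit_interval Y. \<alpha> 0 = y}"

definition continuous_path_covering_property ::
    "'a topology \<Rightarrow> 'b topology \<Rightarrow> ('a \<Rightarrow> 'b) \<Rightarrow> bool" where
  "continuous_path_covering_property E X p \<longleftrightarrow>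
     continuous_map E X p \<and>
     (\<forall>e \<in> topspace E.
        homeomorphic_map (path_space E e) (path_space X (p e))
          (\<lambda>\<alpha>. restrict (p \<circ> \<alpha>) (topspace unit_interval)))"

text \<open>The coordinates of a point of the \<open>n\<close>-cube are indexed by \<open>0, \<dots>, n - 1\<close>.\<close>

definition cube :: "nat \<Rightarrow> (nat \<Rightarrow> real) topology" where
  "cube n = product_topology (\<lambda>_. unit_interval) {..<n}"

definition cube_boundary :: "nat \<Rightarrow> (nat \<Rightarrow> real) set" where
  "cube_boundary n = {x \<in> topspace (cube n). \<exists>i<n. x i = 0 \<or> x i = 1}"

definition loops :: "nat \<Rightarrow> 'a topology \<Rightarrow> 'a \<Rightarrow> ((nat \<Rightarrow> real) \<Rightarrow> 'a) set" where
  "loops n Y y = {f \<in> maps (cube n) Y. \<forall>x \<in> cube_boundary n. f x = y}"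

definition loop_space :: "nat \<Rightarrow> 'a topology \<Rightarrow> 'a \<Rightarrow> ((nat \<Rightarrow> real) \<Rightarrow> 'a) topology" where
  "loop_space n Y y = subtopology (compact_open_topology (cube n) Y) (loops n Y y)"

lemma topspace_loop_space [simp]: "topspace (loop_space n Y y) = loops n Y y"
  by (auto simp: loop_space_def loops_def)

definition loop_homotopy ::
    "nat \<Rightarrow> 'a topology \<Rightarrow> 'a \<Rightarrow> (((nat \<Rightarrow> real) \<Rightarrow> 'a) \<times> ((nat \<Rightarrow> real) \<Rightarrow> 'a)) set" where
  "loop_homotopy n Y y =
     {(f, g). f \<in> loops n Y y \<and> g \<in> loops n Y y \<and>
        homotopic_with (\<lambda>h. \<forall>x \<in> cube_boundary n. h x = y) (cube n) Y f g}"

definition loop_class ::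
    "nat \<Rightarrow> 'a topology \<Rightarrow> 'a \<Rightarrow> ((nat \<Rightarrow> real) \<Rightarrow> 'a) \<Rightarrow> ((nat \<Rightarrow> real) \<Rightarrow> 'a) set" where
  "loop_class n Y y f = loop_homotopy n Y y `` {f}"

text \<open>Concatenation in the first coordinate (meaningful for \<open>n \<ge> 1\<close>).\<close>

definition loop_concat ::
    "nat \<Rightarrow> ((nat \<Rightarrow> real) \<Rightarrow> 'a) \<Rightarrow> ((nat \<Rightarrow> real) \<Rightarrow> 'a) \<Rightarrow> (nat \<Rightarrow> real) \<Rightarrow> 'a" where
  "loop_concat n f g =
     restrict (\<lambda>x. if x 0 \<le> 1/2 then f (x(0 := 2 * x 0)) else g (x(0 := 2 * x 0 - 1)))
       (topspace (cube n))"

text \<open>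
  Closing under homotopy instead of choosing representatives makes the product of two homotopy
  classes the class of the concatenation of any two of their elements.
\<close>

definition homotopy_group ::
    "nat \<Rightarrow> 'a topology \<Rightarrow> 'a \<Rightarrow> ((nat \<Rightarrow> real) \<Rightarrow> 'a) set monoid" where
  "homotopy_group n Y y =
     \<lparr>carrier = loops n Y y // loop_homotopy n Y y,
      mult = (\<lambda>A B. loop_homotopy n Y y `` {loop_concat n f g | f g. f \<in> A \<and> g \<in> B}),
      one = loop_class n Y y (restrict (\<lambda>_. y) (topspace (cube n)))\<rparr>"

definition homotopy_group_topology ::
    "nat \<Rightarrow> 'a topology \<Rightarrow> 'a \<Rightarrow> ((nat \<Rightarrow> real) \<Rightarrow> 'a) set topology" where
  "homotopy_group_topology n Y y =
     topology (\<lambda>U. U \<subseteq> carrier (homotopy_group n Y y) \<and>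
       openin (loop_space n Y y) {f \<in> loops n Y y. loop_class n Y y f \<in> U})"

lemma loop_class_image:
  "loop_class n Y y ` loops n Y y = carrier (homotopy_group n Y y)"
  by (auto simp: loop_class_def homotopy_group_def quotient_def)

lemma openin_homotopy_group_topology:
  "openin (homotopy_group_topology n Y y) U \<longleftrightarrow>
     U \<subseteq> carrier (homotopy_group n Y y) \<and>
     openin (loop_space n Y y) {f \<in> loops n Y y. loop_class n Y y f \<in> U}"
proof -
  let ?P = "\<lambda>U. {f \<in> loops n Y y. loop_class n Y y f \<in> U}"
  have int: "?P (S \<inter> T) = ?P S \<inter> ?P T" for S T by auto
  have un: "?P (\<Union>\<K>) = \<Union> (?P ` \<K>)" for \<K> by auto
  have "istopology (\<lambda>U. U \<subseteq> carrier (homotopy_group n Y y) \<and> openin (loop_space n Y y) (?P U))"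
    unfolding istopology_def int un by (blast intro: openin_Int openin_Union)
  then show ?thesis
    by (simp add: homotopy_group_topology_def topology_inverse')
qed

lemma topspace_homotopy_group_topology [simp]:
  "topspace (homotopy_group_topology n Y y) = carrier (homotopy_group n Y y)"
proof
  show "topspace (homotopy_group_topology n Y y) \<subseteq> carrier (homotopy_group n Y y)"
    using openin_topspace openin_homotopy_group_topology by metis
  have "{f \<in> loops n Y y. loop_class n Y y f \<in> carrier (homotopy_group n Y y)} =
      topspace (loop_space n Y y)"
    using loop_class_image by force
  then have "openin (homotopy_group_topology n Y y) (carrier (homotopy_group n Y y))"
    unfolding openin_homotopy_group_topology by (metis openin_topspace order_refl)
  then show "carrier (homotopy_group n Y y) \<subseteq> topspace (homotopy_group_topology n Y y)"
    by (rule openin_subset)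
qed

lemma quotient_map_loop_class:
  "quotient_map (loop_space n Y y) (homotopy_group_topology n Y y) (loop_class n Y y)"
  by (simp add: quotient_map_def loop_class_image openin_homotopy_group_topology)

text \<open>
  Likewise, the image of a class \<open>A\<close> is the class of \<open>p \<circ> f\<close> for any \<open>f \<in> A\<close>.
\<close>

definition induced_map ::
    "nat \<Rightarrow> 'a topology \<Rightarrow> 'a \<Rightarrow> 'b topology \<Rightarrow> ('a \<Rightarrow> 'b) \<Rightarrow>
      ((nat \<Rightarrow> real) \<Rightarrow> 'a) set \<Rightarrow> ((nat \<Rightarrow> real) \<Rightarrow> 'b) set" where
  "induced_map n E e X p A =
     loop_homotopy n X (p e) `` ((\<lambda>f. restrict (p \<circ> f) (topspace (cube n))) ` A)"

end

theory Submission
  imports Defs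
begin

text \<open>
  A map \<open>f\<close> on the cube is lifted by lifting each radial path \<open>t \<mapsto> f (t x)\<close> through the
  homeomorphism of path spaces and evaluating at the end point; by the exponential law the lift is
  jointly continuous in \<open>x\<close> and in any parameter, in particular in \<open>f\<close> and in the time of a homotopy.
  A path in \<open>E\<close> with constant image in \<open>X\<close> is constant, so homotopies rel boundary lift to
  homotopies rel boundary as soon as one end lifts to a loop.  Hence composition with \<open>p\<close> is a
  closed embedding of loop spaces whose image is a union of homotopy classes (it is cut out by the
  conditions that the lift takes the value \<open>e\<close> on the boundary, and \<open>{e}\<close> is closed), and all this
  descends to the quotients.  For \<open>n \<ge> 2\<close> the boundary of the cube is path connected, so every loop
  lifts to a loop.
\<close>

subsection \<open>The compact-open topology\<close>

text \<open>One half of the exponential law, for arbitrary \<open>Z\<close> and \<open>A\<close>: if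
  \<open>F z\<close> sends a compact \<open>K\<close> into \<open>U\<close>, the tube lemma thickens
  \<open>{z} \<times> K\<close> inside the open preimage of \<open>U\<close>, so all nearby
  parameters do the same.\<close>

lemma continuous_map_curry:
  assumes F: "continuous_map (prod_topology Z A) Y (\<lambda>(z, a). F z a)"
  shows "continuous_map Z (compact_open_topology A Y) (\<lambda>z. restrict (F z) (topspace A))"
  unfolding compact_open_topology_def
proof (rule continuous_on_generated_topo)
  have maps: "restrict (F z) (topspace A) \<in> maps A Y" if "z \<in> topspace Z" for z
  proof -
    have "continuous_map A Y ((\<lambda>(z, a). F z a) \<circ> Pair z)"
      using F that by (rule continuous_map_o_Pair)
    then have "continuous_map A Y (restrict (F z) (topspace A))"
      by (rule continuous_map_eq) auto
    then show ?thesis by (simp add: maps_def)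
  qed
  \<comment> \<open>With \<open>K\<close> and \<open>U\<close> both empty the subbasic set is the
    whole mapping space, so the subbasis covers it.\<close>
  have "maps A Y \<in> {{f \<in> maps A Y. f ` K \<subseteq> U} | K U. compactin A K \<and> openin Y U}"
    by (rule CollectI, rule exI[of _ "{}"], rule exI[of _ "{}"]) auto
  then show "(\<lambda>z. restrict (F z) (topspace A)) ` topspace Z
      \<subseteq> \<Union> {{f \<in> maps A Y. f ` K \<subseteq> U} | K U. compactin A K \<and> openin Y U}"
    using maps by blast
  fix W assume "W \<in> {{f \<in> maps A Y. f ` K \<subseteq> U} | K U. compactin A K \<and> openin Y U}"
  then obtain K U where W: "W = {f \<in> maps A Y. f ` K \<subseteq> U}"
    and K: "compactin A K" and U: "openin Y U" by blast
  have KA: "K \<subseteq> topspace A" using K by (rule compactin_subset_topspace)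
  let ?S = "{q \<in> topspace (prod_topology Z A). (\<lambda>(z, a). F z a) q \<in> U}"
  have S: "openin (prod_topology Z A) ?S"
    using F U by (rule openin_continuous_map_preimage)
  have eq: "(\<lambda>z. restrict (F z) (topspace A)) -` W \<inter> topspace Z
      = {z \<in> topspace Z. F z ` K \<subseteq> U}"
    using maps KA by (auto simp: W image_subset_iff subset_eq)
  show "openin Z ((\<lambda>z. restrict (F z) (topspace A)) -` W \<inter> topspace Z)"
    unfolding eq
  proof (subst openin_subopen, clarify)
    fix z assume z: "z \<in> topspace Z" and sub: "F z ` K \<subseteq> U"
    then have "{z} \<times> K \<subseteq> ?S" using KA by auto
    from tube_lemma_right [OF S K z this] obtain V V' where
      "openin Z V" "z \<in> V" "K \<subseteq> V'" "V \<times> V' \<subseteq> ?S" by blast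
    then show "\<exists>T. openin Z T \<and> z \<in> T \<and> T \<subseteq> {z \<in> topspace Z. F z ` K \<subseteq> U}"
      by (intro exI [of _ V]) (use openin_subset in fastforce)
  qed
qed

lemma openin_compact_open_subbasis:
  "compactin A K \<Longrightarrow> openin Y U \<Longrightarrow> openin (compact_open_topology A Y) {f \<in> maps A Y. f ` K \<subseteq> U}"
  unfolding compact_open_topology_def by (rule topology_generated_by_Basis) blast

text \<open>The other half of the exponential law, where local compactness of \<open>A\<close>
  enters: a compact neighbourhood \<open>K\<close> of \<open>a\<close> that \<open>f\<close> sends
  into \<open>U\<close> yields the subbasic neighbourhood of \<open>f\<close> needed for joint
  continuity.\<close>

lemma continuous_map_eval:
  assumes "neighbourhood_base_of (compactin A) A"
  shows "continuous_map (prod_topology (compact_open_topology A Y) A) Y (\<lambda>(f, a). f a)"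
  unfolding continuous_map_def
proof (intro conjI allI impI)
  show "(\<lambda>(f, a). f a) \<in> topspace (prod_topology (compact_open_topology A Y) A) \<rightarrow> topspace Y"
    by (auto simp: maps_def continuous_map_def)
  fix U assume U: "openin Y U"
  show "openin (prod_topology (compact_open_topology A Y) A)
      {q \<in> topspace (prod_topology (compact_open_topology A Y) A). (case q of (f, a) \<Rightarrow> f a) \<in> U}"
    unfolding openin_prod_topology_alt
  proof (intro allI impI)
    fix f a
    assume "(f, a) \<in> {q \<in> topspace (prod_topology (compact_open_topology A Y) A).
      (case q of (f, a) \<Rightarrow> f a) \<in> U}"
    then have f: "f \<in> maps A Y" and a: "a \<in> topspace A" and fa: "f a \<in> U" by auto
    have "openin A {a \<in> topspace A. f a \<in> U}"
      using f U by (auto simp: maps_def intro: openin_continuous_map_preimage)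
    then obtain V K where V: "openin A V" "a \<in> V" "V \<subseteq> K" and K: "compactin A K"
      and sub: "K \<subseteq> {a \<in> topspace A. f a \<in> U}"
      using assms a fa unfolding neighbourhood_base_of by (metis (mono_tags, lifting) mem_Collect_eq)
    show "\<exists>S T. openin (compact_open_topology A Y) S \<and> openin A T \<and> f \<in> S \<and> a \<in> T \<and>
        S \<times> T \<subseteq> {q \<in> topspace (prod_topology (compact_open_topology A Y) A).
          (case q of (f, a) \<Rightarrow> f a) \<in> U}"
    proof (intro exI conjI)
      show "openin (compact_open_topology A Y) {f \<in> maps A Y. f ` K \<subseteq> U}"
        using K U by (rule openin_compact_open_subbasis)
    qed (use V sub f in auto)
  qed
qed

text \<open>Evaluation at a fixed point needs no local compactness, because singletons are compact.
  It serves for end points of paths and for the values of lifts on the boundary.\<close>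

lemma continuous_map_eval_at:
  assumes "a \<in> topspace A"
  shows "continuous_map (compact_open_topology A Y) Y (\<lambda>f. f a)"
  unfolding continuous_map_def
proof (intro conjI allI impI)
  show "(\<lambda>f. f a) \<in> topspace (compact_open_topology A Y) \<rightarrow> topspace Y"
    using assms by (auto simp: maps_def continuous_map_def)
  fix U assume "openin Y U"
  then have "openin (compact_open_topology A Y) {f \<in> maps A Y. f ` {a} \<subseteq> U}"
    using assms by (intro openin_compact_open_subbasis) auto
  then show "openin (compact_open_topology A Y) {f \<in> topspace (compact_open_topology A Y). f a \<in> U}"
    by simp
qed

lemma topspace_path_space: "topspace (path_space Y y) = {\<alpha> \<in> maps unit_interval Y. \<alpha> 0 = y}"
  by (auto simp: path_space_def)

lemma restrict_in_path_space:
  assumes "continuous_map unit_interval Y \<alpha>" "\<alpha> 0 = y"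
  shows "restrict \<alpha> {0..1} \<in> topspace (path_space Y y)"
proof -
  have "continuous_map unit_interval Y (restrict \<alpha> {0..1})"
    using assms(1) by (rule continuous_map_eq) auto
  then show ?thesis using assms(2) by (simp add: topspace_path_space maps_def)
qed

subsection \<open>The cube\<close>

lemma continuous_map_into_unit_interval:
  "continuous_map Z unit_interval f \<longleftrightarrow>
     continuous_map Z euclideanreal f \<and> (\<forall>z \<in> topspace Z. 0 \<le> f z \<and> f z \<le> 1)"
  by (auto simp: continuous_map_in_subtopology Pi_iff)

lemma topspace_cube: "topspace (cube n) = (\<Pi>\<^sub>E i\<in>{..<n}. {0..1})"
  by (simp add: cube_def)

lemma continuous_map_cube:
  "continuous_map Z (cube n) f \<longleftrightarrow>
     f \<in> topspace Z \<rightarrow> topspace (cube n) \<and> (\<forall>i<n. continuous_map Z euclideanreal (\<lambda>z. f z i))"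
  unfolding cube_def continuous_map_componentwise
  by (auto simp: continuous_map_into_unit_interval Pi_iff PiE_iff)

lemma continuous_map_cube_coordinate:
  "i < n \<Longrightarrow> continuous_map (cube n) euclideanreal (\<lambda>x. x i)"
  using continuous_map_cube [of "cube n" n "\<lambda>x. x"] by simp

text \<open>Compact Hausdorff spaces are locally compact; this supplies the hypothesis of
  \<open>continuous_map_eval\<close>.\<close>

lemma neighbourhood_base_cube: "neighbourhood_base_of (compactin (cube n)) (cube n)"
proof -
  have "compact_space (cube n)"
    unfolding cube_def compact_space_product_topology
    by (simp add: compact_space_subtopology)
  moreover have "Hausdorff_space (cube n)"
    unfolding cube_def Hausdorff_space_product_topology
    by (simp add: Hausdorff_space_subtopology)
  ultimately show ?thesis
    by (simp add: compact_imp_locally_compact_space flip: locally_compact_space_neighbourhood_base)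
qed

text \<open>The radial contraction of the cube. Restricting to the index set keeps the result
  extensional, hence a point of the cube.\<close>

definition scale :: "nat \<Rightarrow> real \<Rightarrow> (nat \<Rightarrow> real) \<Rightarrow> nat \<Rightarrow> real" where
  "scale n t x = (\<lambda>i\<in>{..<n}. t * x i)"

lemma scale_in_cube:
  "t \<in> {0..1} \<Longrightarrow> x \<in> topspace (cube n) \<Longrightarrow> scale n t x \<in> topspace (cube n)"
  by (auto simp: scale_def topspace_cube PiE_iff mult_le_one)

lemma continuous_map_scale:
  assumes "continuous_map Z unit_interval t" "continuous_map Z (cube n) x"
  shows "continuous_map Z (cube n) (\<lambda>z. scale n (t z) (x z))"
  unfolding continuous_map_cube
proof (intro conjI allI impI)
  show "(\<lambda>z. scale n (t z) (x z)) \<in> topspace Z \<rightarrow> topspace (cube n)"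
    using assms by (intro Pi_I scale_in_cube) (auto simp: continuous_map_def)
  fix i assume "i < n"
  then show "continuous_map Z euclideanreal (\<lambda>z. scale n (t z) (x z) i)"
    using assms by (auto simp: scale_def continuous_map_cube continuous_map_into_unit_interval
        intro!: continuous_map_real_mult)
qed

lemma scale_1: "x \<in> topspace (cube n) \<Longrightarrow> scale n 1 x = x"
  by (auto simp: scale_def topspace_cube PiE_iff extensional_def fun_eq_iff)

text \<open>The centre of the contraction is a corner, not the midpoint of the cube: it lies on the
  boundary when \<open>n \<ge> 1\<close>, so every radial path of a loop starts at the base
  point.\<close>

definition origin :: "nat \<Rightarrow> nat \<Rightarrow> real" where
  "origin n = (\<lambda>i\<in>{..<n}. 0)"

lemma scale_0: "scale n 0 x = origin n"
  by (auto simp: scale_def origin_def)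

lemma scale_origin: "scale n t (origin n) = origin n"
  by (auto simp: scale_def origin_def)

lemma origin_in_cube: "origin n \<in> topspace (cube n)"
  by (auto simp: origin_def topspace_cube)

lemma cube_boundary_subset: "cube_boundary n \<subseteq> topspace (cube n)"
  by (auto simp: cube_boundary_def)

lemma origin_in_boundary: "n \<ge> 1 \<Longrightarrow> origin n \<in> cube_boundary n"
  by (auto simp: cube_boundary_def origin_in_cube) (auto simp: origin_def intro!: exI [of _ 0])

subsection \<open>Homotopy classes of loops\<close>

lemma loops_eq:
  "f \<in> loops n Y y \<longleftrightarrow> continuous_map (cube n) Y f \<and> f \<in> extensional (topspace (cube n)) \<and>
     (\<forall>x \<in> cube_boundary n. f x = y)"
  by (auto simp: loops_def maps_def)

lemma loop_origin: "n \<ge> 1 \<Longrightarrow> f \<in> loops n Y y \<Longrightarrow> f (origin n) = y"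
  using origin_in_boundary by (simp add: loops_eq)

lemma loops_maps: "f \<in> loops n Y y \<Longrightarrow> f \<in> maps (cube n) Y"
  by (simp add: loops_def)

lemma homotopic_rel_boundary:
  "homotopic_with (\<lambda>h. \<forall>x \<in> cube_boundary n. h x = y) (cube n) Y f g \<longleftrightarrow>
     (\<exists>h. continuous_map (prod_topology unit_interval (cube n)) Y h \<and>
        (\<forall>x \<in> topspace (cube n). h (0, x) = f x) \<and> (\<forall>x \<in> topspace (cube n). h (1, x) = g x) \<and>
        (\<forall>t \<in> {0..1}. \<forall>x \<in> cube_boundary n. h (t, x) = y))"
  by (rule homotopic_with) (use cube_boundary_subset in \<open>metis subsetD\<close>)

lemma loop_homotopy_sym: "(f, g) \<in> loop_homotopy n Y y \<Longrightarrow> (g, f) \<in> loop_homotopy n Y y"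
  by (simp add: loop_homotopy_def homotopic_with_sym)

lemma loop_homotopy_trans:
  "(f, g) \<in> loop_homotopy n Y y \<Longrightarrow> (g, h) \<in> loop_homotopy n Y y \<Longrightarrow> (f, h) \<in> loop_homotopy n Y y"
  unfolding loop_homotopy_def by (blast intro: homotopic_with_trans)

lemma loop_homotopy_refl: "f \<in> loops n Y y \<Longrightarrow> (f, f) \<in> loop_homotopy n Y y"
  by (simp add: loop_homotopy_def loops_eq)

lemma loop_homotopy_loops:
  "(f, g) \<in> loop_homotopy n Y y \<Longrightarrow> f \<in> loops n Y y \<and> g \<in> loops n Y y"
  by (simp add: loop_homotopy_def)

lemma mem_loop_class: "g \<in> loop_class n Y y f \<longleftrightarrow> (f, g) \<in> loop_homotopy n Y y"
  by (simp add: loop_class_def)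

text \<open>That \<open>f\<close> is a loop matters for the forward direction: outside
  \<open>loops n Y y\<close> all classes are empty and would agree without any homotopy.\<close>

lemma loop_class_eq_iff:
  assumes "f \<in> loops n Y y"
  shows "loop_class n Y y f = loop_class n Y y g \<longleftrightarrow> (f, g) \<in> loop_homotopy n Y y"
proof
  assume eq: "loop_class n Y y f = loop_class n Y y g"
  have "f \<in> loop_class n Y y f"
    using loop_homotopy_refl [OF assms] by (simp only: mem_loop_class)
  then have "(g, f) \<in> loop_homotopy n Y y"
    by (simp only: eq mem_loop_class)
  then show "(f, g) \<in> loop_homotopy n Y y" by (rule loop_homotopy_sym)
next
  assume fg: "(f, g) \<in> loop_homotopy n Y y"
  show "loop_class n Y y f = loop_class n Y y g"
  proof (rule Set.set_eqI)
    fix h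
    show "h \<in> loop_class n Y y f \<longleftrightarrow> h \<in> loop_class n Y y g"
      unfolding mem_loop_class
      by (metis fg loop_homotopy_sym loop_homotopy_trans)
  qed
qed

text \<open>Evaluates the closures under homotopy by which both the product and the induced map are
  defined: a set lying within one class and containing \<open>f\<close> saturates to the class of
  \<open>f\<close>.\<close>

lemma homotopy_image_eq_class:
  assumes "f \<in> S" "\<And>g. g \<in> S \<Longrightarrow> (f, g) \<in> loop_homotopy n Y y"
  shows "loop_homotopy n Y y `` S = loop_class n Y y f"
proof (rule Set.set_eqI)
  fix h
  show "h \<in> loop_homotopy n Y y `` S \<longleftrightarrow> h \<in> loop_class n Y y f"
    unfolding mem_loop_class Image_iff using assms by (metis loop_homotopy_trans)
qed

text \<open>Clamping makes the two reparametrisations continuous self-maps of the whole cube.\<close>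

definition lower :: "(nat \<Rightarrow> real) \<Rightarrow> nat \<Rightarrow> real" where
  "lower x = x(0 := min 1 (2 * x 0))"

definition upper :: "(nat \<Rightarrow> real) \<Rightarrow> nat \<Rightarrow> real" where
  "upper x = x(0 := max 0 (2 * x 0 - 1))"

lemma lower_in_cube: "x \<in> topspace (cube n) \<Longrightarrow> n \<ge> 1 \<Longrightarrow> lower x \<in> topspace (cube n)"
  by (auto simp: lower_def topspace_cube PiE_iff extensional_def)

lemma upper_in_cube: "x \<in> topspace (cube n) \<Longrightarrow> n \<ge> 1 \<Longrightarrow> upper x \<in> topspace (cube n)"
  by (auto simp: upper_def topspace_cube PiE_iff extensional_def)

lemma continuous_map_lower:
  assumes "n \<ge> 1"
  shows "continuous_map (cube n) (cube n) lower"
  unfolding continuous_map_cube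
proof (intro conjI allI impI)
  show "lower \<in> topspace (cube n) \<rightarrow> topspace (cube n)"
    using assms by (intro Pi_I lower_in_cube)
  fix i assume "i < n"
  then show "continuous_map (cube n) euclideanreal (\<lambda>x. lower x i)"
    by (cases "i = 0") (auto simp: lower_def continuous_map_cube_coordinate
        intro!: continuous_map_real_min continuous_map_real_mult)
qed

lemma continuous_map_upper:
  assumes "n \<ge> 1"
  shows "continuous_map (cube n) (cube n) upper"
  unfolding continuous_map_cube
proof (intro conjI allI impI)
  show "upper \<in> topspace (cube n) \<rightarrow> topspace (cube n)"
    using assms by (intro Pi_I upper_in_cube)
  fix i assume "i < n"
  then show "continuous_map (cube n) euclideanreal (\<lambda>x. upper x i)"
    by (cases "i = 0") (auto simp: upper_def continuous_map_cube_coordinate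
        intro!: continuous_map_real_max continuous_map_real_mult continuous_map_diff)
qed

text \<open>Each clamp is inactive on the half of the cube where its branch is used.\<close>

lemma loop_concat_eq:
  "loop_concat n f g =
     (\<lambda>x\<in>topspace (cube n). if x 0 \<le> 1/2 then f (lower x) else g (upper x))"
  unfolding loop_concat_def by (rule restrict_ext) (simp add: lower_def upper_def min.absorb2 max.absorb2)

text \<open>On the other half the clamp pins the first coordinate to 1, and \<open>upper\<close>
  pins it to 0 likewise. At \<open>x 0 = 1/2\<close> both points are therefore on the boundary,
  which is what gluing requires.\<close>

lemma lower_boundary: "x \<in> topspace (cube n) \<Longrightarrow> n \<ge> 1 \<Longrightarrow> 1/2 \<le> x 0 \<Longrightarrow> lower x \<in> cube_boundary n"
  using lower_in_cube [of x n] by (auto simp: cube_boundary_def lower_def intro!: exI [of _ 0])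

lemma upper_boundary: "x \<in> topspace (cube n) \<Longrightarrow> n \<ge> 1 \<Longrightarrow> x 0 \<le> 1/2 \<Longrightarrow> upper x \<in> cube_boundary n"
  using upper_in_cube [of x n] by (auto simp: cube_boundary_def upper_def intro!: exI [of _ 0])

text \<open>Doubling and clamping fixes the values 0 and 1 of the first coordinate and leaves the
  other coordinates alone, so each face goes into itself.\<close>

lemma boundary_lower:
  assumes x: "x \<in> cube_boundary n" and n: "n \<ge> 1"
  shows "lower x \<in> cube_boundary n"
proof -
  have c: "x \<in> topspace (cube n)" using x cube_boundary_subset by blast
  obtain i where i: "i < n" "x i = 0 \<or> x i = 1" using x by (auto simp: cube_boundary_def)
  then have "lower x i = 0 \<or> lower x i = 1" by (auto simp: lower_def)
  then show ?thesis using i lower_in_cube [OF c n] by (auto simp: cube_boundary_def)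
qed

lemma boundary_upper:
  assumes x: "x \<in> cube_boundary n" and n: "n \<ge> 1"
  shows "upper x \<in> cube_boundary n"
proof -
  have c: "x \<in> topspace (cube n)" using x cube_boundary_subset by blast
  obtain i where i: "i < n" "x i = 0 \<or> x i = 1" using x by (auto simp: cube_boundary_def)
  then have "upper x i = 0 \<or> upper x i = 1" by (auto simp: upper_def)
  then show ?thesis using i upper_in_cube [OF c n] by (auto simp: cube_boundary_def)
qed

text \<open>The two homotopies are concatenated at each time. They fit together along
  \<open>x 0 = 1/2\<close> because both are constantly \<open>y\<close> on the boundary.\<close>

lemma homotopic_loop_concat:
  assumes n: "n \<ge> 1"
    and f: "homotopic_with (\<lambda>h. \<forall>x \<in> cube_boundary n. h x = y) (cube n) Y f f'"
    and g: "homotopic_with (\<lambda>h. \<forall>x \<in> cube_boundary n. h x = y) (cube n) Y g g'"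
  shows "homotopic_with (\<lambda>h. \<forall>x \<in> cube_boundary n. h x = y) (cube n) Y
    (loop_concat n f g) (loop_concat n f' g')"
proof -
  let ?W = "prod_topology unit_interval (cube n)"
  obtain h where h: "continuous_map ?W Y h" and
    h01: "\<And>x. x \<in> topspace (cube n) \<Longrightarrow> h (0, x) = f x" "\<And>x. x \<in> topspace (cube n) \<Longrightarrow> h (1, x) = f' x" and
    hb: "\<And>t x. t \<in> {0..1} \<Longrightarrow> x \<in> cube_boundary n \<Longrightarrow> h (t, x) = y"
    using f unfolding homotopic_rel_boundary by blast
  obtain k where k: "continuous_map ?W Y k" and
    k01: "\<And>x. x \<in> topspace (cube n) \<Longrightarrow> k (0, x) = g x" "\<And>x. x \<in> topspace (cube n) \<Longrightarrow> k (1, x) = g' x" and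
    kb: "\<And>t x. t \<in> {0..1} \<Longrightarrow> x \<in> cube_boundary n \<Longrightarrow> k (t, x) = y"
    using g unfolding homotopic_rel_boundary by blast
  let ?H = "\<lambda>w. if snd w 0 \<le> 1/2 then h (fst w, lower (snd w)) else k (fst w, upper (snd w))"
  have low: "continuous_map ?W Y (\<lambda>w. h (fst w, lower (snd w)))"
    using continuous_map_compose [OF continuous_map_pairedI [OF continuous_map_fst
          continuous_map_compose [OF continuous_map_snd continuous_map_lower [OF n]]] h]
    by (simp add: o_def)
  have up: "continuous_map ?W Y (\<lambda>w. k (fst w, upper (snd w)))"
    using continuous_map_compose [OF continuous_map_pairedI [OF continuous_map_fst
          continuous_map_compose [OF continuous_map_snd continuous_map_upper [OF n]]] k]
    by (simp add: o_def)
  have coord: "continuous_map ?W euclideanreal (\<lambda>w. snd w 0)"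
    using continuous_map_compose [OF continuous_map_snd continuous_map_cube_coordinate [of 0 n]] n
    by (simp add: o_def)
  have "continuous_map ?W Y ?H"
  proof (rule continuous_map_cases_le [OF coord])
    fix w assume w: "w \<in> topspace ?W" and half: "snd w 0 = 1/2"
    then have "lower (snd w) \<in> cube_boundary n" "upper (snd w) \<in> cube_boundary n"
      using n by (auto intro!: lower_boundary upper_boundary)
    then show "h (fst w, lower (snd w)) = k (fst w, upper (snd w))"
      using w hb kb by auto
  qed (simp_all add: low up continuous_map_from_subtopology)
  then show ?thesis
    unfolding homotopic_rel_boundary
  proof (intro exI conjI)
    show "\<forall>x\<in>topspace (cube n). ?H (0, x) = loop_concat n f g x"
      by (simp add: loop_concat_eq h01 k01 lower_in_cube [OF _ n] upper_in_cube [OF _ n])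
    show "\<forall>x\<in>topspace (cube n). ?H (1, x) = loop_concat n f' g' x"
      by (simp add: loop_concat_eq h01 k01 lower_in_cube [OF _ n] upper_in_cube [OF _ n])
    show "\<forall>t\<in>{0..1}. \<forall>x\<in>cube_boundary n. ?H (t, x) = y"
      using n by (auto simp: hb kb boundary_lower boundary_upper)
  qed
qed

lemma loop_homotopy_concat:
  assumes n: "n \<ge> 1" and f: "(f, f') \<in> loop_homotopy n Y y" and g: "(g, g') \<in> loop_homotopy n Y y"
  shows "(loop_concat n f g, loop_concat n f' g') \<in> loop_homotopy n Y y"
proof -
  have hom: "homotopic_with (\<lambda>h. \<forall>x \<in> cube_boundary n. h x = y) (cube n) Y
      (loop_concat n f g) (loop_concat n f' g')"
    using f g by (intro homotopic_loop_concat [OF n]) (auto simp: loop_homotopy_def)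
  have "loop_concat n a b \<in> extensional (topspace (cube n))" for a b :: "(nat \<Rightarrow> real) \<Rightarrow> 'a"
    by (simp add: loop_concat_def)
  then show ?thesis
    using hom homotopic_with_imp_continuous_maps [OF hom] homotopic_with_imp_property [OF hom]
    by (simp add: loop_homotopy_def loops_eq)
qed

lemma mult_loop_class:
  assumes "n \<ge> 1" "f \<in> loops n Y y" "g \<in> loops n Y y"
  shows "mult (homotopy_group n Y y) (loop_class n Y y f) (loop_class n Y y g)
    = loop_class n Y y (loop_concat n f g)"
proof -
  have "loop_homotopy n Y y `` {loop_concat n f' g' | f' g'.
      f' \<in> loop_class n Y y f \<and> g' \<in> loop_class n Y y g} = loop_class n Y y (loop_concat n f g)"
  proof (rule homotopy_image_eq_class)
    show "loop_concat n f g \<in> {loop_concat n f' g' | f' g'.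
        f' \<in> loop_class n Y y f \<and> g' \<in> loop_class n Y y g}"
      using loop_homotopy_refl [OF assms(2)] loop_homotopy_refl [OF assms(3)]
      by (auto simp only: mem_loop_class)
  qed (use loop_homotopy_concat [OF assms(1)] in \<open>auto simp: mem_loop_class\<close>)
  then show ?thesis by (simp add: homotopy_group_def)
qed

lemma loop_concat_in_loops:
  "n \<ge> 1 \<Longrightarrow> f \<in> loops n Y y \<Longrightarrow> g \<in> loops n Y y \<Longrightarrow> loop_concat n f g \<in> loops n Y y"
  by (rule loop_homotopy_loops [OF loop_homotopy_concat [OF _ loop_homotopy_refl loop_homotopy_refl],
        THEN conjunct1])

subsection \<open>Lifting along a map with the continuous path-covering property\<close>

locale path_covering =
  fixes E :: "'a topology" and X :: "'b topology" and p :: "'a \<Rightarrow> 'b" and e :: 'a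
  assumes covering: "continuous_path_covering_property E X p"
    and basepoint: "e \<in> topspace E"
begin

lemma continuous_p: "continuous_map E X p"
  using covering by (simp add: continuous_path_covering_property_def)

definition lift :: "(real \<Rightarrow> 'b) \<Rightarrow> real \<Rightarrow> 'a" where
  "lift = inv_into (topspace (path_space E e)) (\<lambda>\<alpha>. restrict (p \<circ> \<alpha>) (topspace unit_interval))"

lemma homeomorphic_covering:
  "e' \<in> topspace E \<Longrightarrow> homeomorphic_map (path_space E e') (path_space X (p e'))
     (\<lambda>\<alpha>. restrict (p \<circ> \<alpha>) (topspace unit_interval))"
  using covering by (simp add: continuous_path_covering_property_def)

lemma restrict_lift:
  "\<alpha> \<in> topspace (path_space X (p e)) \<Longrightarrow> restrict (p \<circ> lift \<alpha>) (topspace unit_interval) = \<alpha>"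
  using homeomorphic_imp_surjective_map [OF homeomorphic_covering [OF basepoint]]
    f_inv_into_f [of \<alpha> "\<lambda>\<alpha>. restrict (p \<circ> \<alpha>) (topspace unit_interval)" "topspace (path_space E e)"]
  unfolding lift_def by (simp only:)

lemma lift_restrict:
  "\<alpha> \<in> topspace (path_space E e) \<Longrightarrow> lift (restrict (p \<circ> \<alpha>) (topspace unit_interval)) = \<alpha>"
  unfolding lift_def using homeomorphic_imp_injective_map [OF homeomorphic_covering [OF basepoint]]
  by (rule inv_into_f_f)

text \<open>The inverse of a bijective open map is continuous; openness is part of the homeomorphism
  given by the covering property at \<open>e\<close>.\<close>

lemma continuous_map_lift: "continuous_map (path_space X (p e)) (path_space E e) lift"
proof -
  let ?P = "\<lambda>\<alpha>. restrict (p \<circ> \<alpha>) (topspace unit_interval)"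
  have surj: "?P ` topspace (path_space E e) = topspace (path_space X (p e))"
    by (rule homeomorphic_imp_surjective_map [OF homeomorphic_covering [OF basepoint]])
  have "open_map (path_space E e) (path_space X (p e)) ?P"
    by (rule homeomorphic_imp_open_map [OF homeomorphic_covering [OF basepoint]])
  moreover have "open_map (path_space E e) (path_space X (p e)) ?P \<longleftrightarrow>
      continuous_map (path_space X (p e)) (path_space E e) lift"
  proof (rule open_eq_continuous_inverse_map)
    fix \<alpha> assume "\<alpha> \<in> topspace (path_space E e)"
    then show "?P \<alpha> \<in> topspace (path_space X (p e)) \<and> lift (?P \<alpha>) = \<alpha>"
      using surj lift_restrict by blast
  next
    fix \<beta> assume b: "\<beta> \<in> topspace (path_space X (p e))"
    then have "lift \<beta> \<in> topspace (path_space E e)"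
      unfolding lift_def surj [symmetric] by (rule inv_into_into)
    then show "lift \<beta> \<in> topspace (path_space E e) \<and> ?P (lift \<beta>) = \<beta>"
      using restrict_lift b by blast
  qed
  ultimately show ?thesis by blast
qed

text \<open>The path and the constant path at its starting point have the same projection, so
  injectivity on paths starting at \<open>\<gamma> 0\<close> identifies them. The covering property
  is used here at a point other than \<open>e\<close> in general.\<close>

lemma constant_if_constant_image:
  assumes \<gamma>: "continuous_map unit_interval E \<gamma>" and const: "\<And>t. t \<in> {0..1} \<Longrightarrow> p (\<gamma> t) = p (\<gamma> 0)"
    and t: "t \<in> {0..1}"
  shows "\<gamma> t = \<gamma> 0"
proof -
  let ?I = "topspace unit_interval" and ?\<alpha> = "restrict \<gamma> {0..1}" and ?\<beta> = "\<lambda>s\<in>{0..1::real}. \<gamma> 0"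
  have g0: "\<gamma> 0 \<in> topspace E"
    using \<gamma> by (auto simp: continuous_map_def)
  have "continuous_map unit_interval E ?\<alpha>"
    using \<gamma> by (rule continuous_map_eq) auto
  then have a: "?\<alpha> \<in> topspace (path_space E (\<gamma> 0))"
    by (simp add: topspace_path_space maps_def)
  have "continuous_map unit_interval E ?\<beta>"
    by (rule continuous_map_eq [of _ _ "\<lambda>_. \<gamma> 0"]) (use g0 in auto)
  then have b: "?\<beta> \<in> topspace (path_space E (\<gamma> 0))"
    by (simp add: topspace_path_space maps_def)
  have eq: "restrict (p \<circ> ?\<alpha>) ?I = restrict (p \<circ> ?\<beta>) ?I"
  proof (rule restrict_ext)
    fix s assume "s \<in> topspace unit_interval"
    then show "(p \<circ> ?\<alpha>) s = (p \<circ> ?\<beta>) s" using const [of s] by simp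
  qed
  have "?\<alpha> = ?\<beta>"
    by (rule inj_onD [OF homeomorphic_imp_injective_map [OF homeomorphic_covering [OF g0]] eq a b])
  then have "?\<alpha> t = ?\<beta> t" by (rule fun_cong)
  then show ?thesis using t by simp
qed

text \<open>The restriction turns any function on the reals into an extensional one, so path
  formulas can be supplied directly and only their values on the unit interval count.\<close>

definition lift_end :: "(real \<Rightarrow> 'b) \<Rightarrow> 'a" where
  "lift_end \<alpha> = lift (restrict \<alpha> {0..1}) 1"

lemma lift_end_cong: "(\<And>t. t \<in> {0..1} \<Longrightarrow> \<alpha> t = \<beta> t) \<Longrightarrow> lift_end \<alpha> = lift_end \<beta>"
  unfolding lift_end_def by (simp cong: restrict_cong)

lemma p_lift_end:
  assumes "continuous_map unit_interval X \<alpha>" "\<alpha> 0 = p e"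
  shows "p (lift_end \<alpha>) = \<alpha> 1"
  using fun_cong [OF restrict_lift [OF restrict_in_path_space [OF assms]], of 1]
  by (simp add: lift_end_def)

text \<open>A path starting at \<open>e\<close> is the unique lift of its own projection.\<close>

lemma lift_end_p:
  assumes "continuous_map unit_interval E \<alpha>" "\<alpha> 0 = e"
  shows "lift_end (\<lambda>t. p (\<alpha> t)) = \<alpha> 1"
proof -
  have "restrict (\<lambda>t. p (\<alpha> t)) {0..1} = restrict (p \<circ> restrict \<alpha> {0..1}) (topspace unit_interval)"
    by (auto simp: fun_eq_iff)
  then show ?thesis
    using lift_restrict [OF restrict_in_path_space [OF assms]] by (simp add: lift_end_def)
qed

text \<open>The composite of currying into the path space of \<open>X\<close>, lifting, and
  evaluating at 1; each factor is continuous.\<close>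

lemma continuous_map_lift_end:
  assumes G: "continuous_map (prod_topology Z unit_interval) X (\<lambda>(z, t). G z t)"
    and G0: "\<And>z. z \<in> topspace Z \<Longrightarrow> G z 0 = p e"
  shows "continuous_map Z E (\<lambda>z. lift_end (G z))"
proof -
  have "continuous_map Z (path_space X (p e)) (\<lambda>z. restrict (G z) {0..1})"
    unfolding path_space_def
  proof (rule continuous_map_into_subtopology)
    show c: "continuous_map Z (compact_open_topology unit_interval X) (\<lambda>z. restrict (G z) {0..1})"
      using continuous_map_curry [OF G] by simp
    then have "(\<lambda>z. restrict (G z) {0..1}) \<in> topspace Z \<rightarrow> maps unit_interval X"
      by (simp add: continuous_map_def)
    then show "(\<lambda>z. restrict (G z) {0..1}) \<in> topspace Z \<rightarrow> {\<alpha> \<in> maps unit_interval X. \<alpha> 0 = p e}"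
      using G0 by auto
  qed
  then have "continuous_map Z (path_space E e) (lift \<circ> (\<lambda>z. restrict (G z) {0..1}))"
    using continuous_map_lift by (rule continuous_map_compose)
  then have "continuous_map Z (compact_open_topology unit_interval E)
      (lift \<circ> (\<lambda>z. restrict (G z) {0..1}))"
    unfolding path_space_def by (rule continuous_map_into_fulltopology)
  then have "continuous_map Z E ((\<lambda>\<alpha>. \<alpha> 1) \<circ> (lift \<circ> (\<lambda>z. restrict (G z) {0..1})))"
    by (rule continuous_map_compose) (simp add: continuous_map_eval_at)
  then show ?thesis by (simp add: o_def lift_end_def)
qed

definition cube_lift :: "nat \<Rightarrow> ((nat \<Rightarrow> real) \<Rightarrow> 'b) \<Rightarrow> (nat \<Rightarrow> real) \<Rightarrow> 'a" where
  "cube_lift n f = (\<lambda>x\<in>topspace (cube n). lift_end (\<lambda>t. f (scale n t x)))"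

definition push :: "nat \<Rightarrow> ((nat \<Rightarrow> real) \<Rightarrow> 'a) \<Rightarrow> (nat \<Rightarrow> real) \<Rightarrow> 'b" where
  "push n f = restrict (p \<circ> f) (topspace (cube n))"

text \<open>The pair of parameter and cube point is treated as a single parameter of a family of
  radial paths, so \<open>continuous_map_lift_end\<close> gives joint continuity. The cases used
  take \<open>Z\<close> to be a point, the time interval of a homotopy, and a loop space.\<close>

lemma continuous_map_family_lift:
  assumes F: "continuous_map (prod_topology Z (cube n)) X (\<lambda>(z, x). F z x)"
    and F0: "\<And>z. z \<in> topspace Z \<Longrightarrow> F z (origin n) = p e"
  shows "continuous_map (prod_topology Z (cube n)) E (\<lambda>(z, x). lift_end (\<lambda>t. F z (scale n t x)))"
proof -
  let ?W = "prod_topology (prod_topology Z (cube n)) unit_interval"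
  have "continuous_map ?W X ((\<lambda>(z, x). F z x) \<circ>
      (\<lambda>w. (fst (fst w), scale n (snd w) (snd (fst w)))))"
  proof (rule continuous_map_compose [OF _ F], rule continuous_map_pairedI)
    show "continuous_map ?W Z (\<lambda>w. fst (fst w))"
      using continuous_map_compose [OF continuous_map_fst continuous_map_fst] by (simp add: o_def)
    show "continuous_map ?W (cube n) (\<lambda>w. scale n (snd w) (snd (fst w)))"
      using continuous_map_compose [OF continuous_map_fst continuous_map_snd]
      by (intro continuous_map_scale continuous_map_snd) (simp add: o_def)
  qed
  \<comment> \<open>The integrand is written as a function of the pair \<open>q\<close> applied to
    \<open>t\<close>, to match the shape \<open>G z t\<close> of the lifting lemma.\<close>
  then have "continuous_map ?W X (\<lambda>(q, t). (\<lambda>(z, x) t. F z (scale n t x)) q t)"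
    by (simp add: o_def case_prod_unfold)
  then have "continuous_map (prod_topology Z (cube n)) E
      (\<lambda>q. lift_end ((\<lambda>(z, x) t. F z (scale n t x)) q))"
    by (rule continuous_map_lift_end) (auto simp: scale_0 F0)
  then show ?thesis by (simp add: case_prod_unfold)
qed

lemma continuous_map_radial:
  assumes "continuous_map (cube n) Y f" "x \<in> topspace (cube n)"
  shows "continuous_map unit_interval Y (\<lambda>t. f (scale n t x))"
proof -
  have "continuous_map unit_interval (cube n) (\<lambda>t. scale n t x)"
    using assms(2) by (intro continuous_map_scale) auto
  then have "continuous_map unit_interval Y (f \<circ> (\<lambda>t. scale n t x))"
    using assms(1) by (rule continuous_map_compose)
  then show ?thesis by (simp add: o_def)
qed

text \<open>The radial paths of \<open>f\<close> start at \<open>e\<close> and lift those of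
  \<open>p \<circ> f\<close>, so by uniqueness their end points are the values of the lift.\<close>

lemma cube_lift_push:
  assumes f: "f \<in> maps (cube n) E" and f0: "f (origin n) = e"
  shows "cube_lift n (push n f) = f"
proof
  fix x
  show "cube_lift n (push n f) x = f x"
  proof (cases "x \<in> topspace (cube n)")
    case True
    have cf: "continuous_map (cube n) E f" using f by (simp add: maps_def)
    have "lift_end (\<lambda>t. push n f (scale n t x)) = lift_end (\<lambda>t. p (f (scale n t x)))"
      using True by (intro lift_end_cong) (simp add: push_def scale_in_cube)
    also have "\<dots> = f (scale n 1 x)"
      using continuous_map_radial [OF cf True] by (rule lift_end_p) (simp add: scale_0 f0)
    finally show ?thesis using True by (simp add: cube_lift_def scale_1)
  next
    case False
    then show ?thesis using f by (simp add: cube_lift_def maps_def extensional_def)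
  qed
qed

lemma p_cube_lift:
  assumes "continuous_map (cube n) X f" "f (origin n) = p e" "x \<in> topspace (cube n)"
  shows "p (cube_lift n f x) = f x"
  using p_lift_end [OF continuous_map_radial [OF assms(1,3)]] assms(2,3)
  by (simp add: cube_lift_def scale_0 scale_1)

lemma push_cube_lift:
  assumes "f \<in> maps (cube n) X" "f (origin n) = p e"
  shows "push n (cube_lift n f) = f"
  using assms p_cube_lift [of n f] by (auto simp: push_def maps_def extensional_def fun_eq_iff)

lemma cube_lift_maps:
  assumes f: "continuous_map (cube n) X f" and f0: "f (origin n) = p e"
  shows "cube_lift n f \<in> maps (cube n) E"
proof -
  \<comment> \<open>A single map is a family over a one-point space.\<close>
  let ?Z = "discrete_topology {()}"
  have "continuous_map (prod_topology ?Z (cube n)) X (f \<circ> snd)"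
    by (rule continuous_map_compose [OF continuous_map_snd f])
  then have "continuous_map (prod_topology ?Z (cube n)) E
      (\<lambda>(z, x). lift_end (\<lambda>t. f (scale n t x)))"
    by (intro continuous_map_family_lift) (simp_all add: o_def case_prod_unfold f0)
  from continuous_map_o_Pair [OF this, of "()"]
  have "continuous_map (cube n) E (\<lambda>x. lift_end (\<lambda>t. f (scale n t x)))"
    by (simp add: o_def)
  then have "continuous_map (cube n) E (cube_lift n f)"
    by (rule continuous_map_eq) (simp add: cube_lift_def)
  then show ?thesis by (simp add: maps_def cube_lift_def)
qed

text \<open>The radial path at the origin is constant, and so is its lift.\<close>

lemma cube_lift_origin:
  assumes "f (origin n) = p e"
  shows "cube_lift n f (origin n) = e"
proof -
  have "lift_end (\<lambda>t. p e) = e"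
    by (rule lift_end_p [of "\<lambda>_. e"]) (simp_all add: basepoint)
  then show ?thesis by (simp add: cube_lift_def scale_origin origin_in_cube assms)
qed

subsection \<open>The induced map on homotopy groups\<close>

lemma push_in_loops:
  assumes "f \<in> loops n E e"
  shows "push n f \<in> loops n X (p e)"
proof -
  have "continuous_map (cube n) X (p \<circ> f)"
    using assms continuous_p by (auto simp: loops_eq intro: continuous_map_compose)
  then have "continuous_map (cube n) X (push n f)"
    by (rule continuous_map_eq) (simp add: push_def)
  moreover have "\<forall>x\<in>cube_boundary n. push n f x = p e"
    using assms cube_boundary_subset [of n] by (auto simp: loops_eq push_def)
  ultimately show ?thesis by (simp add: loops_eq push_def)
qed

lemma push_homotopy:
  assumes "(f, g) \<in> loop_homotopy n E e"
  shows "(push n f, push n g) \<in> loop_homotopy n X (p e)"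
proof -
  have fg: "f \<in> loops n E e" "g \<in> loops n E e"
    and "homotopic_with (\<lambda>h. \<forall>x \<in> cube_boundary n. h x = e) (cube n) E f g"
    using assms by (auto simp: loop_homotopy_def)
  then have "homotopic_with (\<lambda>h. \<forall>x \<in> cube_boundary n. h x = p e) (cube n) X (p \<circ> f) (p \<circ> g)"
    using continuous_p by (elim homotopic_with_compose_continuous_map_left) auto
  then have "homotopic_with (\<lambda>h. \<forall>x \<in> cube_boundary n. h x = p e) (cube n) X (push n f) (push n g)"
    unfolding homotopic_rel_boundary by (simp add: push_def)
  then show ?thesis
    using fg by (simp add: loop_homotopy_def push_in_loops)
qed

lemma induced_map_loop_class:
  assumes "f \<in> loops n E e"
  shows "induced_map n E e X p (loop_class n E e f) = loop_class n X (p e) (push n f)"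
  unfolding induced_map_def push_def [symmetric]
proof (rule homotopy_image_eq_class)
  show "push n f \<in> push n ` loop_class n E e f"
    using loop_homotopy_refl [OF assms] by (intro imageI) (simp add: mem_loop_class)
qed (auto simp: mem_loop_class push_homotopy)

text \<open>On the boundary a lifted homotopy runs inside a fibre, hence is stationary.\<close>

lemma cube_lift_homotopy:
  assumes n: "n \<ge> 1" and fg: "(f, g) \<in> loop_homotopy n X (p e)"
    and lf: "cube_lift n f \<in> loops n E e"
  shows "(cube_lift n f, cube_lift n g) \<in> loop_homotopy n E e"
proof -
  let ?W = "prod_topology unit_interval (cube n)"
  obtain h where h: "continuous_map ?W X h" and
    h0: "\<And>x. x \<in> topspace (cube n) \<Longrightarrow> h (0, x) = f x" and
    h1: "\<And>x. x \<in> topspace (cube n) \<Longrightarrow> h (1, x) = g x" and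
    hb: "\<And>t x. t \<in> {0..1} \<Longrightarrow> x \<in> cube_boundary n \<Longrightarrow> h (t, x) = p e"
    using fg unfolding loop_homotopy_def homotopic_rel_boundary by blast
  \<comment> \<open>The homotopy is lifted at each time along radial paths of the cube; the lifts
    start at \<open>e\<close> because the origin is a boundary point and stays at
    \<open>p e\<close>.\<close>
  let ?k = "\<lambda>(s, x). lift_end (\<lambda>t. h (s, scale n t x))"
  have k: "continuous_map ?W E ?k"
    using continuous_map_family_lift [of unit_interval n "\<lambda>s x. h (s, x)"] h hb
      origin_in_boundary [OF n] by simp
  have k0: "?k (0, x) = cube_lift n f x" if "x \<in> topspace (cube n)" for x
    using that by (auto simp: cube_lift_def h0 scale_in_cube intro!: lift_end_cong)
  have k1: "?k (1, x) = cube_lift n g x" if "x \<in> topspace (cube n)" for x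
    using that by (auto simp: cube_lift_def h1 scale_in_cube intro!: lift_end_cong)
  have pk: "p (?k (s, x)) = h (s, x)" if s: "s \<in> {0..1}" and x: "x \<in> topspace (cube n)" for s x
  proof -
    have "continuous_map (cube n) X (\<lambda>x. h (s, x))"
      using continuous_map_o_Pair [OF h, of s] s by (simp add: o_def)
    from p_lift_end [OF continuous_map_radial [OF this x]] show ?thesis
      using hb [OF s origin_in_boundary [OF n]] x by (simp add: scale_0 scale_1)
  qed
  have kb: "?k (s, x) = e" if s: "s \<in> {0..1}" and x: "x \<in> cube_boundary n" for s x
  proof -
    have xc: "x \<in> topspace (cube n)" using x cube_boundary_subset by blast
    have "continuous_map unit_interval E (?k \<circ> (\<lambda>s. (s, x)))"
      by (rule continuous_map_compose [OF _ k]) (simp add: continuous_map_pairedI xc)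
    then have "continuous_map unit_interval E (\<lambda>s. ?k (s, x))"
      by (simp only: o_def)
    moreover have "p (?k (s, x)) = p (?k (0, x))" if "s \<in> {0..1}" for s
      using that x xc pk hb by simp
    ultimately have "?k (s, x) = ?k (0, x)"
      using s by (rule constant_if_constant_image)
    \<comment> \<open>The stationary value is read off at time 0, where the lift is a loop by
      assumption.\<close>
    also have "\<dots> = e" using lf x xc k0 by (simp add: loops_eq)
    finally show ?thesis .
  qed
  have "homotopic_with (\<lambda>h. \<forall>x \<in> cube_boundary n. h x = e) (cube n) E (cube_lift n f) (cube_lift n g)"
    unfolding homotopic_rel_boundary
    by (rule exI [of _ ?k]) (use k k0 k1 kb in blast)
  \<comment> \<open>Nothing was assumed about the lift of \<open>g\<close>; that it is a loop is the
    case of time 1 of \<open>kb\<close>.\<close>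
  moreover have "cube_lift n g \<in> loops n E e"
  proof -
    have "g \<in> loops n X (p e)" using fg by (simp add: loop_homotopy_def)
    then have "cube_lift n g \<in> maps (cube n) E"
      using n by (intro cube_lift_maps) (auto simp: loops_eq origin_in_boundary)
    moreover have "cube_lift n g x = e" if "x \<in> cube_boundary n" for x
      using that kb [of 1 x] k1 [of x] cube_boundary_subset [of n] by auto
    ultimately show ?thesis by (simp add: loops_def)
  qed
  ultimately show ?thesis using lf by (simp add: loop_homotopy_def)
qed

lemma cube_lift_push_loop: "n \<ge> 1 \<Longrightarrow> f \<in> loops n E e \<Longrightarrow> cube_lift n (push n f) = f"
  by (simp add: cube_lift_push loops_maps loop_origin)

lemma push_cube_lift_loop: "n \<ge> 1 \<Longrightarrow> f \<in> loops n X (p e) \<Longrightarrow> push n (cube_lift n f) = f"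
  by (simp add: push_cube_lift loops_maps loop_origin)

text \<open>Shows that the image of \<open>push n\<close> on loops is a union of homotopy classes
  and that homotopies descend back to \<open>E\<close>; injectivity and closedness of the induced
  map both rest on it.\<close>

lemma push_homotopy_lift:
  assumes n: "n \<ge> 1" and f: "f \<in> loops n E e" and fg: "(push n f, g) \<in> loop_homotopy n X (p e)"
  shows "(f, cube_lift n g) \<in> loop_homotopy n E e"
  using cube_lift_homotopy [OF n fg] f by (simp add: cube_lift_push_loop [OF n])

lemma inj_induced_map:
  assumes n: "n \<ge> 1"
  shows "inj_on (induced_map n E e X p) (carrier (homotopy_group n E e))"
  unfolding loop_class_image [symmetric]
proof (rule inj_onI, clarify)
  fix f g assume fg: "f \<in> loops n E e" "g \<in> loops n E e"
    and "induced_map n E e X p (loop_class n E e f) = induced_map n E e X p (loop_class n E e g)"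
  then have "(push n f, push n g) \<in> loop_homotopy n X (p e)"
    by (simp add: induced_map_loop_class loop_class_eq_iff push_in_loops)
  then have "(f, g) \<in> loop_homotopy n E e"
    using push_homotopy_lift [OF n fg(1)] cube_lift_push_loop [OF n fg(2)] by metis
  then show "loop_class n E e f = loop_class n E e g"
    by (simp add: loop_class_eq_iff fg)
qed

section \<open>Topology of loop spaces and of homotopy groups under composition with
  \<open>p\<close>\<close>

lemma continuous_map_push:
  "continuous_map (loop_space n E e) (loop_space n X (p e)) (push n)"
proof -
  \<comment> \<open>By the exponential law it suffices that evaluation followed by \<open>p\<close>
    is jointly continuous.\<close>
  have "continuous_map (prod_topology (compact_open_topology (cube n) E) (cube n)) X
      (p \<circ> (\<lambda>(f, x). f x))"
    by (rule continuous_map_compose [OF continuous_map_eval [OF neighbourhood_base_cube] continuous_p])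
  then have "continuous_map (prod_topology (compact_open_topology (cube n) E) (cube n)) X
      (\<lambda>(f, x). (p \<circ> f) x)"
    by (simp add: o_def case_prod_unfold)
  from continuous_map_curry [OF this]
  have "continuous_map (compact_open_topology (cube n) E) (compact_open_topology (cube n) X) (push n)"
    by (simp add: push_def [abs_def] o_def)
  then have "continuous_map (loop_space n E e) (compact_open_topology (cube n) X) (push n)"
    unfolding loop_space_def by (rule continuous_map_from_subtopology)
  then show ?thesis
    unfolding loop_space_def [of n X]
    by (rule continuous_map_into_subtopology) (use push_in_loops in auto)
qed

text \<open>The target is the full mapping space, since for \<open>n = 1\<close> the lift of a loop
  may end away from \<open>e\<close>.\<close>

lemma continuous_map_cube_lift:
  assumes n: "n \<ge> 1"
  shows "continuous_map (loop_space n X (p e)) (compact_open_topology (cube n) E) (cube_lift n)"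
proof -
  have "continuous_map (loop_space n X (p e)) (compact_open_topology (cube n) X) id"
    unfolding loop_space_def by (rule continuous_map_from_subtopology) simp
  then have "continuous_map (prod_topology (loop_space n X (p e)) (cube n))
      (prod_topology (compact_open_topology (cube n) X) (cube n)) (\<lambda>q. (fst q, snd q))"
    by (intro continuous_map_pairedI continuous_map_snd)
       (metis continuous_map_compose continuous_map_fst id_comp)
  from continuous_map_compose [OF this continuous_map_eval [OF neighbourhood_base_cube]]
  have "continuous_map (prod_topology (loop_space n X (p e)) (cube n)) X (\<lambda>(f, x). f x)"
    by (simp add: o_def case_prod_unfold)
  then have "continuous_map (prod_topology (loop_space n X (p e)) (cube n)) E
      (\<lambda>(f, x). (\<lambda>x. lift_end (\<lambda>t. f (scale n t x))) x)"
    by (rule continuous_map_family_lift) (simp add: loop_origin [OF n])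
  from continuous_map_curry [OF this] show ?thesis
    by (simp add: cube_lift_def [abs_def])
qed

text \<open>The image of \<open>C\<close> consists of the loops whose lift lies in \<open>D\<close>
  and equals \<open>e\<close> at every boundary point. The first condition is closed by continuity
  of lifting, the others because \<open>{e}\<close> is closed.\<close>

lemma closed_map_push:
  assumes n: "n \<ge> 1" and closed: "closedin E {e}"
  shows "closed_map (loop_space n E e) (loop_space n X (p e)) (push n)"
  unfolding closed_map_def
proof (intro allI impI)
  fix C assume C: "closedin (loop_space n E e) C"
  then obtain D where D: "closedin (compact_open_topology (cube n) E) D" and CD: "C = D \<inter> loops n E e"
    by (auto simp: loop_space_def closedin_subtopology)
  let ?LX = "loop_space n X (p e)"
  let ?fib = "\<lambda>x. {g \<in> topspace ?LX. cube_lift n g x \<in> {e}}"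
  have fib: "closedin ?LX (?fib x)" if "x \<in> cube_boundary n" for x
  proof (rule closedin_continuous_map_preimage [OF _ closed])
    have "x \<in> topspace (cube n)" using that cube_boundary_subset by blast
    from continuous_map_compose [OF continuous_map_cube_lift [OF n] continuous_map_eval_at [OF this]]
    show "continuous_map ?LX E (\<lambda>g. cube_lift n g x)" by (simp add: o_def)
  qed
  have "closedin ?LX ({g \<in> topspace ?LX. cube_lift n g \<in> D} \<inter> (\<Inter>x\<in>cube_boundary n. ?fib x))"
  proof (intro closedin_Int closedin_INT)
    show "closedin ?LX {g \<in> topspace ?LX. cube_lift n g \<in> D}"
      by (rule closedin_continuous_map_preimage [OF continuous_map_cube_lift [OF n] D])
    \<comment> \<open>An intersection of closed sets is taken over the boundary, so the index set
      must be non-empty.\<close>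
    show "cube_boundary n \<noteq> {}" using origin_in_boundary [OF n] by blast
  qed (use fib in blast)
  moreover have "{g \<in> topspace ?LX. cube_lift n g \<in> D} \<inter> (\<Inter>x\<in>cube_boundary n. ?fib x) = push n ` C"
  proof (intro equalityI subsetI)
    fix g assume g: "g \<in> {g \<in> topspace ?LX. cube_lift n g \<in> D} \<inter> (\<Inter>x\<in>cube_boundary n. ?fib x)"
    then have gl: "g \<in> loops n X (p e)" by simp
    then have "cube_lift n g \<in> maps (cube n) E"
      using n by (intro cube_lift_maps) (auto simp: loops_eq origin_in_boundary)
    then have "cube_lift n g \<in> C" using g by (auto simp: CD loops_def)
    then show "g \<in> push n ` C"
      by (rule rev_image_eqI) (simp add: push_cube_lift_loop [OF n gl])
  next
    fix g assume "g \<in> push n ` C"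
    then obtain f where "f \<in> D" and f: "f \<in> loops n E e" and "g = push n f" by (auto simp: CD)
    then show "g \<in> {g \<in> topspace ?LX. cube_lift n g \<in> D} \<inter> (\<Inter>x\<in>cube_boundary n. ?fib x)"
      by (auto simp: cube_lift_push_loop [OF n] push_in_loops loops_eq [of f])
  qed
  ultimately show "closedin ?LX (push n ` C)" by simp
qed

lemma continuous_induced_map:
  "continuous_map (homotopy_group_topology n E e) (homotopy_group_topology n X (p e))
     (induced_map n E e X p)"
proof (rule continuous_compose_quotient_map [OF quotient_map_loop_class])
  have "continuous_map (loop_space n E e) (homotopy_group_topology n X (p e))
      (loop_class n X (p e) \<circ> push n)"
    by (rule continuous_map_compose [OF continuous_map_push
          quotient_imp_continuous_map [OF quotient_map_loop_class]])
  then show "continuous_map (loop_space n E e) (homotopy_group_topology n X (p e))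
      (induced_map n E e X p \<circ> loop_class n E e)"
    by (rule continuous_map_eq) (simp add: induced_map_loop_class)
qed

text \<open>Closedness in a quotient is tested on preimages. The preimage of the image of
  \<open>C\<close> is the \<open>push\<close> image of the preimage of \<open>C\<close>, hence
  closed by \<open>closed_map_push\<close>.\<close>

lemma closed_induced_map:
  assumes n: "n \<ge> 1" and closed: "closedin E {e}"
  shows "closed_map (homotopy_group_topology n E e) (homotopy_group_topology n X (p e))
    (induced_map n E e X p)"
  unfolding closed_map_def
proof (intro allI impI)
  let ?ind = "induced_map n E e X p" and ?LX = "loop_space n X (p e)"
  fix C assume C: "closedin (homotopy_group_topology n E e) C"
  have C_sub: "C \<subseteq> loop_class n E e ` loops n E e"
    using closedin_subset [OF C] by (simp add: loop_class_image)
  let ?D = "{f \<in> topspace (loop_space n E e). loop_class n E e f \<in> C}"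
  have "closedin (loop_space n E e) ?D"
    by (rule closedin_continuous_map_preimage [OF quotient_imp_continuous_map [OF quotient_map_loop_class] C])
  then have "closedin ?LX (push n ` ?D)"
    using closed_map_push [OF n closed] by (simp add: closed_map_def)
  moreover have "push n ` ?D = {g \<in> topspace ?LX. loop_class n X (p e) g \<in> ?ind ` C}"
  proof (intro equalityI subsetI)
    fix g assume "g \<in> push n ` ?D"
    then obtain f where f: "f \<in> loops n E e" "loop_class n E e f \<in> C" "g = push n f" by auto
    then have "loop_class n X (p e) g = ?ind (loop_class n E e f)"
      by (simp add: induced_map_loop_class)
    then show "g \<in> {g \<in> topspace ?LX. loop_class n X (p e) g \<in> ?ind ` C}"
      using f by (simp add: push_in_loops)
  next
    fix g assume "g \<in> {g \<in> topspace ?LX. loop_class n X (p e) g \<in> ?ind ` C}"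
    then have g: "g \<in> loops n X (p e)" and "loop_class n X (p e) g \<in> ?ind ` C" by auto
    then obtain f where f: "f \<in> loops n E e" and fC: "loop_class n E e f \<in> C"
      and "loop_class n X (p e) g = loop_class n X (p e) (push n f)"
      using C_sub induced_map_loop_class by force
    then have "(push n f, g) \<in> loop_homotopy n X (p e)"
      using loop_class_eq_iff [OF push_in_loops [OF f]] by metis
    \<comment> \<open>A loop homotopic to some \<open>push n f\<close> is itself pushed from a loop
      in the class of \<open>f\<close>, namely its own lift.\<close>
    then have fg: "(f, cube_lift n g) \<in> loop_homotopy n E e"
      by (rule push_homotopy_lift [OF n f])
    then have "cube_lift n g \<in> ?D"
      using fC loop_class_eq_iff [OF f, of "cube_lift n g"] loop_homotopy_loops [OF fg] by simp
    then show "g \<in> push n ` ?D"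
      by (rule rev_image_eqI) (simp add: push_cube_lift_loop [OF n g])
  qed
  moreover have "?ind ` C \<subseteq> topspace (homotopy_group_topology n X (p e))"
    using C_sub by (auto simp: induced_map_loop_class push_in_loops simp flip: loop_class_image)
  ultimately show "closedin (homotopy_group_topology n X (p e)) (?ind ` C)"
    using quotient_map_loop_class [of n X "p e"] unfolding quotient_map_closedin by simp
qed

section \<open>The homomorphism property\<close>

lemma push_loop_concat:
  assumes n: "n \<ge> 1"
  shows "push n (loop_concat n f g) = loop_concat n (push n f) (push n g)"
  unfolding loop_concat_eq push_def
  by (rule restrict_ext) (simp add: lower_in_cube [OF _ n] upper_in_cube [OF _ n])

lemma hom_induced_map:
  assumes n: "n \<ge> 1"
  shows "induced_map n E e X p \<in> hom (homotopy_group n E e) (homotopy_group n X (p e))"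
proof (rule homI)
  fix A assume "A \<in> carrier (homotopy_group n E e)"
  then show "induced_map n E e X p A \<in> carrier (homotopy_group n X (p e))"
    by (auto simp: induced_map_loop_class push_in_loops simp flip: loop_class_image)
next
  fix A B assume "A \<in> carrier (homotopy_group n E e)" "B \<in> carrier (homotopy_group n E e)"
  then obtain f g where fg: "f \<in> loops n E e" "g \<in> loops n E e"
    and AB: "A = loop_class n E e f" "B = loop_class n E e g"
    by (auto simp flip: loop_class_image)
  then show "induced_map n E e X p (A \<otimes>\<^bsub>homotopy_group n E e\<^esub> B) =
      induced_map n E e X p A \<otimes>\<^bsub>homotopy_group n X (p e)\<^esub> induced_map n E e X p B"
    by (simp only: mult_loop_class [OF n] induced_map_loop_class loop_concat_in_loops [OF n]
        push_in_loops push_loop_concat [OF n])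
qed

section \<open>Lifts of loops along the boundary, and surjectivity for
  \<open>n \<ge> 2\<close>\<close>

lemma cube_lift_constant_along:
  assumes n: "n \<ge> 1" and f: "f \<in> loops n X (p e)"
    and \<gamma>: "continuous_map unit_interval (cube n) \<gamma>"
    and bd: "\<And>t. t \<in> {0..1} \<Longrightarrow> \<gamma> t \<in> cube_boundary n"
  shows "cube_lift n f (\<gamma> 1) = cube_lift n f (\<gamma> 0)"
proof -
  have f': "continuous_map (cube n) X f" "f (origin n) = p e"
    using f n by (auto simp: loops_eq origin_in_boundary)
  have "continuous_map (cube n) E (cube_lift n f)"
    using cube_lift_maps [OF f'] by (simp add: maps_def)
  from continuous_map_compose [OF \<gamma> this]
  have "continuous_map unit_interval E (\<lambda>t. cube_lift n f (\<gamma> t))" by (simp add: o_def)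
  \<comment> \<open>Along a boundary path the lift stays in the fibre over \<open>p e\<close>, so it
    cannot move.\<close>
  moreover have "p (cube_lift n f (\<gamma> t)) = p e" if "t \<in> {0..1}" for t
    using bd [OF that] f p_cube_lift [OF f'] cube_boundary_subset by (force simp: loops_eq)
  ultimately show ?thesis
    by (intro constant_if_constant_image [of "\<lambda>t. cube_lift n f (\<gamma> t)"]) auto
qed

text \<open>For \<open>n \<ge> 2\<close> the origin is joined to any point of the boundary inside the boundary: a radial
  segment reaches the faces through the origin, and any face \<open>x i = 1\<close> contains a segment that
  shrinks another coordinate to \<open>0\<close>.\<close>

lemma cube_lift_in_loops:
  assumes n: "n \<ge> 2" and f: "f \<in> loops n X (p e)"
  shows "cube_lift n f \<in> loops n E e"
proof -
  have n1: "n \<ge> 1" using n by simp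
  have f0: "f (origin n) = p e" using n1 f by (rule loop_origin)
  have zero: "cube_lift n f x = e" if x: "x \<in> topspace (cube n)" and i: "i < n" "x i = 0" for x i
  proof -
    \<comment> \<open>Scaling preserves the vanishing coordinate, so the whole radial segment stays
      in the face \<open>x i = 0\<close>.\<close>
    have "cube_lift n f (scale n 1 x) = cube_lift n f (scale n 0 x)"
    proof (rule cube_lift_constant_along [OF n1 f])
      show "continuous_map unit_interval (cube n) (\<lambda>t. scale n t x)"
        using x by (intro continuous_map_scale) auto
      show "scale n t x \<in> cube_boundary n" if "t \<in> {0..1}" for t
        using scale_in_cube [OF that x] i by (auto simp: cube_boundary_def scale_def)
    qed
    then show ?thesis by (simp add: scale_0 scale_1 x cube_lift_origin f0)
  qed
  have one: "cube_lift n f x = e" if x: "x \<in> topspace (cube n)" and i: "i < n" "x i = 1" for x i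
  proof -
    \<comment> \<open>A second coordinate, available because \<open>n \<ge> 2\<close>. Shrinking it
      keeps the point on the face \<open>x i = 1\<close> and ends on the face
      \<open>x j = 0\<close>, where \<open>zero\<close> applies.\<close>
    define j where "j = (if i = 0 then 1 else 0 :: nat)"
    have j: "j < n" "j \<noteq> i" using n by (auto simp: j_def)
    let ?\<gamma> = "\<lambda>t. x(j := t * x j)"
    have \<gamma>: "?\<gamma> t \<in> topspace (cube n)" if "t \<in> {0..1}" for t
      using that x j by (auto simp: topspace_cube PiE_iff extensional_def mult_le_one)
    have "cube_lift n f (?\<gamma> 1) = cube_lift n f (?\<gamma> 0)"
    proof (rule cube_lift_constant_along [OF n1 f])
      show "continuous_map unit_interval (cube n) ?\<gamma>"
        unfolding continuous_map_cube
      proof (intro conjI allI impI)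
        show "?\<gamma> \<in> topspace unit_interval \<rightarrow> topspace (cube n)"
          using \<gamma> by (intro Pi_I) simp
        show "continuous_map unit_interval euclideanreal (\<lambda>t. ?\<gamma> t k)" for k
          by (cases "k = j") (auto intro!: continuous_intros)
      qed
      show "?\<gamma> t \<in> cube_boundary n" if "t \<in> {0..1}" for t
        using \<gamma> [OF that] i j by (auto simp: cube_boundary_def)
    qed
    also have "\<dots> = e"
      by (rule zero [OF \<gamma> j(1)]) auto
    finally show ?thesis by simp
  qed
  have "cube_lift n f \<in> maps (cube n) E"
    using f f0 by (intro cube_lift_maps) (auto simp: loops_eq)
  moreover have "cube_lift n f x = e" if "x \<in> cube_boundary n" for x
    using that zero one unfolding cube_boundary_def by blast
  ultimately show ?thesis by (simp add: loops_def)
qed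

lemma surj_induced_map:
  assumes n: "n \<ge> 2"
  shows "induced_map n E e X p ` carrier (homotopy_group n E e) = carrier (homotopy_group n X (p e))"
proof -
  have n1: "n \<ge> 1" using n by simp
  have "push n ` loops n E e = loops n X (p e)"
  proof (intro equalityI subsetI)
    fix g assume g: "g \<in> loops n X (p e)"
    show "g \<in> push n ` loops n E e"
      by (rule rev_image_eqI [OF cube_lift_in_loops [OF n g]]) (simp add: push_cube_lift_loop [OF n1 g])
  qed (auto simp: push_in_loops)
  then have "carrier (homotopy_group n X (p e)) = loop_class n X (p e) ` push n ` loops n E e"
    by (simp only: loop_class_image)
  also have "\<dots> = induced_map n E e X p ` loop_class n E e ` loops n E e"
    unfolding image_image by (rule image_cong) (simp_all add: induced_map_loop_class)
  finally show ?thesis by (simp only: loop_class_image)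
qed

end

theorem theorem5p2:
  fixes E :: "'a topology" and X :: "'b topology" and p :: "'a \<Rightarrow> 'b" and e :: 'a
  assumes "topspace E \<noteq> {}" and "path_connected_space E"
    and "topspace X \<noteq> {}" and "path_connected_space X"
    and "e \<in> topspace E" and "closedin E {e}"
    and "continuous_path_covering_property E X p"
  shows "(induced_map 1 E e X p \<in> hom (homotopy_group 1 E e) (homotopy_group 1 X (p e)) \<and>
          embedding_map (homotopy_group_topology 1 E e) (homotopy_group_topology 1 X (p e))
            (induced_map 1 E e X p) \<and>
          closed_map (homotopy_group_topology 1 E e) (homotopy_group_topology 1 X (p e))
            (induced_map 1 E e X p)) \<and>
         (\<forall>n\<ge>2.
            induced_map n E e X p \<in> iso (homotopy_group n E e) (homotopy_group n X (p e)) \<and>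
            homeomorphic_map (homotopy_group_topology n E e) (homotopy_group_topology n X (p e))
              (induced_map n E e X p))"
proof -
  interpret path_covering E X p e
    by unfold_locales (fact assms)+
  show ?thesis
  proof (intro conjI allI impI)
    show "induced_map 1 E e X p \<in> hom (homotopy_group 1 E e) (homotopy_group 1 X (p e))"
      by (rule hom_induced_map) simp
    show closed: "closed_map (homotopy_group_topology 1 E e) (homotopy_group_topology 1 X (p e))
        (induced_map 1 E e X p)"
      by (rule closed_induced_map) (simp_all add: assms)
    show "embedding_map (homotopy_group_topology 1 E e) (homotopy_group_topology 1 X (p e))
        (induced_map 1 E e X p)"
      \<comment> \<open>A continuous closed injection is an embedding; for \<open>n \<ge> 2\<close>
        surjectivity turns the same argument into a homeomorphism.\<close>
      by (rule injective_closed_imp_embedding_map [OF continuous_induced_map closed])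
         (simp add: inj_induced_map)
  next
    fix n :: nat assume n: "2 \<le> n"
    then have n1: "1 \<le> n" by simp
    show "induced_map n E e X p \<in> iso (homotopy_group n E e) (homotopy_group n X (p e))"
      unfolding iso_def bij_betw_def
      using hom_induced_map [OF n1] inj_induced_map [OF n1] surj_induced_map [OF n] by blast
    show "homeomorphic_map (homotopy_group_topology n E e) (homotopy_group_topology n X (p e))
        (induced_map n E e X p)"
      by (rule bijective_closed_imp_homeomorphic_map [OF continuous_induced_map
            closed_induced_map [OF n1 assms(6)]])
         (simp_all add: inj_induced_map [OF n1] surj_induced_map [OF n])
  qed
qed

end
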